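(* A parametrized by arclength timelike extremal in $(\mathrm{GL}^+(2,\mathbb{C}),d)$ is nonstrictly abnormal if and only if it is a 1-parameter subgroup with an initial unit vector in $(H,\langle\cdot,\cdot\rangle)$ (i.e. $g(t)=\exp(tX)$ with $X\in H$, $\langle X,X\rangle=1$), or a left shift of such a 1-parameter subgroup.
   Context: $\mathrm{GL}^+(2,\mathbb{C})$ is the Lie group of complex $2\times2$ matrices with positive real determinant; $\mathfrak{g}=\mathfrak{gl}^+(2,\mathbb{C})$ is its Lie algebra (complex $2\times2$ matrices with real trace). Let $e_0=\frac12 I$, $e_1=\frac12\begin{pmatrix}0&1\\1&0\end{pmatrix}$, $e_2=\frac12\begin{pmatrix}0&\mathbf{i}\\-\mathbf{i}&0\end{pmatrix}$, $e_3=\frac12\begin{pmatrix}1&0\\0&-1\end{pmatrix}$. $H=\mathrm{span}_{\mathbb{R}}(e_0,\dots,e_3)$ is the space of Hermitian matrices, with pseudoscalar product $\langle\cdot,\cdot\rangle$ whose quadratic form is $\langle h,h\rangle=h_0^2-h_1^2-h_2^2-h_3^2=4\det h$ for $h=\sum h_ie_i$. $l_g:h\mapsto gh$ is the left shift. $d(x,y)$ is the supremum of lengths $\int\sqrt{\langle u,u\rangle}\,dt$ of Lipschitzian curves from $x$ to $y$ with $g'(t)=dl_{g(t)}(u(t))$, where for almost all $t$ $u(t)\in H$, $\langle u(t),u(t)\rangle\ge0$, $\langle u(t),e_0\rangle>0$ ($-\infty$ if there are none). Let $U=\{u\in H\mid\langle u,u\rangle\ge1,\ \langle u,e_0\rangle>0\}$.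 A (parametrized by arclength) timelike extremal is a Lipschitzian curve $g(t)$, $t\in\mathbb{R}$, with $g'(t)=dl_{g(t)}(u(t))$, $u(t)\in U$ measurable, $\langle u(t),u(t)\rangle=1$ a.e., for which there is an absolutely continuous nowhere vanishing covector function $\psi(t)\in\mathfrak{g}^*$ such that for almost all $t$: $\frac{d}{dt}\psi(t)(w)=\psi(t)([u(t),w])$ for all $w\in\mathfrak{g}$, and $\psi(t)(u(t))=\min_{u\in U}\psi(t)(u)=M_0$ with a constant $M_0\ge0$. It is normal with respect to $\psi$ if $M_0>0$ and abnormal with respect to $\psi$ if $M_0=0$. An extremal is nonstrictly abnormal if it is abnormal with respect to some covector function and normal with respect to some (other) covector function. *)

theory Defs
  imports "HOL-Analysis.Analysis"
begin

definition GL_plus :: "(complex^2^2) set" where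
  "GL_plus = {A. det A \<in> \<real> \<and> 0 < Re (det A)}"

text \<open>The Lie algebra \<open>gl_plus\<close> is only a real subspace of the space of all complex matrices.\<close>

definition gl_plus :: "(complex^2^2) set" where
  "gl_plus = {A. trace A \<in> \<real>}"

definition lie_bracket :: "complex^2^2 \<Rightarrow> complex^2^2 \<Rightarrow> complex^2^2" where
  "lie_bracket A B = A ** B - B ** A"

definition e0 :: "complex^2^2" where
  "e0 = (1/2) *\<^sub>R vector [vector [1, 0], vector [0, 1]]"

definition e1 :: "complex^2^2" where
  "e1 = (1/2) *\<^sub>R vector [vector [0, 1], vector [1, 0]]"

definition e2 :: "complex^2^2" where
  "e2 = (1/2) *\<^sub>R vector [vector [0, \<i>], vector [- \<i>, 0]]"

definition e3 :: "complex^2^2" where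
  "e3 = (1/2) *\<^sub>R vector [vector [1, 0], vector [0, - 1]]"

definition Herm :: "(complex^2^2) set" where
  "Herm = span {e0, e1, e2, e3}"

text \<open>With respect to the Euclidean inner product of \<open>complex^2^2\<close>, the matrices \<open>e0, \<dots>, e3\<close> are
  pairwise orthogonal and have squared norm \<open>1/2\<close>. Hence \<open>2 * (h \<bullet> e)\<close>, for \<open>e\<close> one of them, is the
  coefficient of \<open>h \<in> Herm\<close> at \<open>e\<close>; see \<open>Herm_expansion\<close> and \<open>pseudo_inner_combination\<close> below.\<close>

definition herm_coord :: "complex^2^2 \<Rightarrow> complex^2^2 \<Rightarrow> real" where
  "herm_coord e h = 2 * (h \<bullet> e)"

definition pseudo_inner :: "complex^2^2 \<Rightarrow> complex^2^2 \<Rightarrow> real" where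
  "pseudo_inner h k =
     herm_coord e0 h * herm_coord e0 k - herm_coord e1 h * herm_coord e1 k
     - herm_coord e2 h * herm_coord e2 k - herm_coord e3 h * herm_coord e3 k"

lemma herm_coord_e:
  "herm_coord e0 h = Re (h $ 1 $ 1) + Re (h $ 2 $ 2)"
  "herm_coord e1 h = Re (h $ 1 $ 2) + Re (h $ 2 $ 1)"
  "herm_coord e2 h = Im (h $ 1 $ 2) - Im (h $ 2 $ 1)"
  "herm_coord e3 h = Re (h $ 1 $ 1) - Re (h $ 2 $ 2)"
  by (simp_all add: herm_coord_def e0_def e1_def e2_def e3_def inner_vec_def sum_2 inner_complex_def)

lemma herm_coord_combination:
  defines "h \<equiv> \<lambda>a b c d. a *\<^sub>R e0 + b *\<^sub>R e1 + c *\<^sub>R e2 + d *\<^sub>R e3"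
  shows "herm_coord e0 (h a b c d) = a" "herm_coord e1 (h a b c d) = b"
    "herm_coord e2 (h a b c d) = c" "herm_coord e3 (h a b c d) = d"
  unfolding h_def herm_coord_e
  by (simp_all add: e0_def e1_def e2_def e3_def)

lemma pseudo_inner_combination:
  "pseudo_inner (a *\<^sub>R e0 + b *\<^sub>R e1 + c *\<^sub>R e2 + d *\<^sub>R e3)
     (a' *\<^sub>R e0 + b' *\<^sub>R e1 + c' *\<^sub>R e2 + d' *\<^sub>R e3) = a * a' - b * b' - c * c' - d * d'"
  by (simp add: pseudo_inner_def herm_coord_combination)

lemma Herm_expansion:
  assumes "h \<in> Herm"
  shows "h = herm_coord e0 h *\<^sub>R e0 + herm_coord e1 h *\<^sub>R e1 + herm_coord e2 h *\<^sub>R e2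
    + herm_coord e3 h *\<^sub>R e3"
proof -
  obtain a b c d where "h - a *\<^sub>R e0 - b *\<^sub>R e1 - c *\<^sub>R e2 = d *\<^sub>R e3"
    using assms unfolding Herm_def by (auto simp: span_insert span_singleton)
  then have "h = a *\<^sub>R e0 + b *\<^sub>R e1 + c *\<^sub>R e2 + d *\<^sub>R e3"
    by (simp add: algebra_simps)
  then show ?thesis
    by (simp add: herm_coord_combination)
qed

lemma pseudo_inner_det:
  assumes "h \<in> Herm"
  shows "complex_of_real (pseudo_inner h h) = 4 * det h"
proof -
  obtain a b c d where h: "h = a *\<^sub>R e0 + b *\<^sub>R e1 + c *\<^sub>R e2 + d *\<^sub>R e3"
    using Herm_expansion[OF assms] by blast
  show ?thesis
    unfolding h pseudo_inner_combination det_2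
    by (simp add: e0_def e1_def e2_def e3_def complex_eq_iff algebra_simps)
qed

definition U_set :: "(complex^2^2) set" where
  "U_set = {u \<in> Herm. pseudo_inner u u \<ge> 1 \<and> pseudo_inner u e0 > 0}"

definition matrix_exp :: "complex^2^2 \<Rightarrow> complex^2^2" where
  "matrix_exp A = (\<Sum>n. (1 / fact n) *\<^sub>R (((**) A ^^ n) (mat 1)))"

definition abs_continuous_on :: "real set \<Rightarrow> (real \<Rightarrow> real) \<Rightarrow> bool" where
  "abs_continuous_on S f \<longleftrightarrow>
     (\<forall>\<epsilon>>0. \<exists>\<delta>>0. \<forall>D. D division_of \<Union>D \<and> \<Union>D \<subseteq> S \<and> (\<Sum>K\<in>D. Sup K - Inf K) < \<delta>
        \<longrightarrow> (\<Sum>K\<in>D. \<bar>f (Sup K) - f (Inf K)\<bar>) < \<epsilon>)"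

text \<open>An element of the real dual of \<open>gl_plus\<close> is represented by any function on matrices that is
  real linear on \<open>gl_plus\<close>; its values outside \<open>gl_plus\<close> are never used.\<close>

definition covector :: "(complex^2^2 \<Rightarrow> real) \<Rightarrow> bool" where
  "covector f \<longleftrightarrow> (\<forall>v\<in>gl_plus. \<forall>w\<in>gl_plus. \<forall>a b. f (a *\<^sub>R v + b *\<^sub>R w) = a * f v + b * f w)"

text \<open>Absolute continuity of a curve in the finite-dimensional dual space is
  absolute continuity of its evaluations, on every compact interval.\<close>

definition covector_function :: "(real \<Rightarrow> complex^2^2 \<Rightarrow> real) \<Rightarrow> bool" where
  "covector_function \<psi> \<longleftrightarrow>
     (\<forall>t. covector (\<psi> t)) \<and>
     (\<forall>t. \<exists>w\<in>gl_plus. \<psi> t w \<noteq> 0) \<and>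
     (\<forall>w\<in>gl_plus. \<forall>a b. abs_continuous_on {a..b} (\<lambda>t. \<psi> t w))"

text \<open>The left shift \<open>\<lambda>h. g ** h\<close> is linear, so its differential sends \<open>u\<close> to \<open>g ** u\<close>.
  The Lipschitz condition is imposed on compact intervals: in the matrix norm,
  1-parameter subgroups are not globally Lipschitz.\<close>

definition timelike_curve :: "(real \<Rightarrow> complex^2^2) \<Rightarrow> (real \<Rightarrow> complex^2^2) \<Rightarrow> bool" where
  "timelike_curve g u \<longleftrightarrow>
     (\<forall>t. g t \<in> GL_plus) \<and>
     (\<forall>a b. \<exists>C. C-lipschitz_on {a..b} g) \<and>
     u \<in> borel_measurable lebesgue \<and>
     (\<forall>t. u t \<in> U_set) \<and>
     (AE t in lebesgue. pseudo_inner (u t) (u t) = 1) \<and>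
     (AE t in lebesgue. (g has_vector_derivative g t ** u t) (at t))"

definition extremal_wrt ::
  "(real \<Rightarrow> complex^2^2) \<Rightarrow> (real \<Rightarrow> complex^2^2 \<Rightarrow> real) \<Rightarrow> real \<Rightarrow> bool" where
  "extremal_wrt g \<psi> M \<longleftrightarrow>
     (\<exists>u. timelike_curve g u \<and> covector_function \<psi> \<and> M \<ge> 0 \<and>
        (AE t in lebesgue. \<forall>w\<in>gl_plus.
           ((\<lambda>s. \<psi> s w) has_real_derivative \<psi> t (lie_bracket (u t) w)) (at t)) \<and>
        (AE t in lebesgue. is_arg_min (\<psi> t) (\<lambda>v. v \<in> U_set) (u t) \<and> \<psi> t (u t) = M))"

definition timelike_extremal :: "(real \<Rightarrow> complex^2^2) \<Rightarrow> bool" where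
  "timelike_extremal g \<longleftrightarrow> (\<exists>\<psi> M. extremal_wrt g \<psi> M)"

definition normal_wrt :: "(real \<Rightarrow> complex^2^2) \<Rightarrow> (real \<Rightarrow> complex^2^2 \<Rightarrow> real) \<Rightarrow> bool" where
  "normal_wrt g \<psi> \<longleftrightarrow> (\<exists>M>0. extremal_wrt g \<psi> M)"

definition abnormal_wrt :: "(real \<Rightarrow> complex^2^2) \<Rightarrow> (real \<Rightarrow> complex^2^2 \<Rightarrow> real) \<Rightarrow> bool" where
  "abnormal_wrt g \<psi> \<longleftrightarrow> extremal_wrt g \<psi> 0"

definition nonstrictly_abnormal :: "(real \<Rightarrow> complex^2^2) \<Rightarrow> bool" where
  "nonstrictly_abnormal g \<longleftrightarrow> (\<exists>\<psi>. abnormal_wrt g \<psi>) \<and> (\<exists>\<psi>. normal_wrt g \<psi>)"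

definition unit_one_parameter_subgroup :: "(real \<Rightarrow> complex^2^2) \<Rightarrow> bool" where
  "unit_one_parameter_subgroup g \<longleftrightarrow>
     (\<exists>X\<in>Herm. pseudo_inner X X = 1 \<and> (\<forall>t. g t = matrix_exp (t *\<^sub>R X)))"

end

theory Submission
  imports Defs
begin

text \<open>
  The proof compares an abnormal and a normal covector function along the same curve.

  Minimality over \<open>U_set\<close> determines a covector on Herm: if the minimum \<open>M\<close> is attained at a unit
  vector \<open>u\<close>, then the covector is \<open>M\<close> times the pseudoscalar product with \<open>u\<close> there
  (\<open>minimizing_covector_on_Herm\<close>). Write \<open>u\<close> as a time coordinate and a spatial vector in \<open>\<real>\<^sup>3\<close>.
  Brackets of Hermitian matrices are, up to the factor \<open>-i\<close>, cross products of spatial vectors.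

  For \<open>M = 0\<close> the covector vanishes on Herm, so it is given by a vector \<open>p\<close> on the skew-Hermitian
  traceless matrices. The adjoint equation makes \<open>p\<close> constant and parallel to the spatial part of
  the control (\<open>abnormal_extremal_control_parallel\<close>). A normal covector function is then constant on the two
  matrices that commute with the control, the unit \<open>e0\<close> and the Hermitian matrix with spatial
  vector \<open>p\<close>. Its values there give the time coordinate of the control and the component of its
  spatial part along \<open>p\<close>, so the control is constant almost everywhere
  (\<open>nonstrictly_abnormal_control_constant\<close>). A locally Lipschitz curve with constant control \<open>X\<close> is
  \<open>g 0 ** matrix_exp (t *\<^sub>R X)\<close> (\<open>lipschitz_solution_eq_matrix_exp\<close>).

  Conversely, along a curve with constant control \<open>X\<close> every covector annihilating all brackets
  \<open>[X, w]\<close> is a constant solution of the adjoint equation. The pseudoscalar product with \<open>X\<close> is a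
  normal one, and a covector that vanishes on Herm and is parallel to \<open>X\<close> on the skew-Hermitian
  part is an abnormal one.

  The analytic ingredient is that an absolutely continuous function with zero derivative almost
  everywhere is constant (\<open>zero_derivative_ae_imp_eq\<close>); it turns almost everywhere statements about
  the derivatives of the covectors and of the curve into conservation laws.
\<close>

section \<open>Absolutely continuous functions with zero derivative almost everywhere\<close>

text \<open>Take a division of the interval that is fine for a suitable gauge. At a tag where the derivative
  vanishes, the increment of \<open>f\<close> is at most \<open>\<epsilon>\<close> times the length of the interval. The remaining tags
  lie in a null set, so the gauge can force their intervals into an open set of measure below the
  \<open>\<delta>\<close> of absolute continuity, and their increments add up to at most \<open>\<epsilon>\<close>. The values are vectors
  because the argument serves both the evaluations of a covector curve and curves of matrices.\<close>

lemma zero_derivative_ae_imp_eq: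
  fixes f :: "real \<Rightarrow> 'a::real_normed_vector"
  assumes "a \<le> b"
    and ac: "\<And>\<epsilon>. \<epsilon> > 0 \<Longrightarrow> \<exists>\<delta>>0. \<forall>D. D division_of \<Union>D \<and> \<Union>D \<subseteq> {a..b} \<and> (\<Sum>K\<in>D. Sup K - Inf K) < \<delta>
        \<longrightarrow> (\<Sum>K\<in>D. norm (f (Sup K) - f (Inf K))) < \<epsilon>"
    and der: "AE t in lebesgue. (f has_vector_derivative 0) (at t)"
  shows "f a = f b"
proof -
  have le: "norm (f b - f a) \<le> \<epsilon> * (b - a) + \<epsilon>" if "\<epsilon> > 0" for \<epsilon>
  proof -
    obtain \<delta> where "\<delta> > 0" and \<delta>: "\<And>D. D division_of \<Union>D \<Longrightarrow> \<Union>D \<subseteq> {a..b} \<Longrightarrow>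
        (\<Sum>K\<in>D. Sup K - Inf K) < \<delta> \<Longrightarrow> (\<Sum>K\<in>D. norm (f (Sup K) - f (Inf K))) < \<epsilon>"
      using ac[OF \<open>\<epsilon> > 0\<close>] by blast
    define N where "N = {t. \<not> (f has_vector_derivative 0) (at t)}"
    have N: "N \<in> null_sets lebesgue"
      using der unfolding N_def by (simp add: completion.AE_iff_null_sets)
    \<comment> \<open>a thin open neighbourhood of the exceptional set\<close>
    then obtain V where V: "open V" "N \<subseteq> V" "V - N \<in> lmeasurable" "emeasure lebesgue (V - N) < ennreal \<delta>"
      using sets_lebesgue_outer_open[of N \<delta>] \<open>\<delta> > 0\<close> by auto
    have V_meas: "V \<in> lmeasurable" "measure lebesgue V < \<delta>"
    proof -
      have "emeasure lebesgue V = emeasure lebesgue (V - N)"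
        using V(1) N by (intro emeasure_Diff_null_set[symmetric]) auto
      then have *: "emeasure lebesgue V < ennreal \<delta>" using V(4) by simp
      then show m: "V \<in> lmeasurable"
        using V(1) by (intro fmeasurableI) (auto intro: less_trans)
      show "measure lebesgue V < \<delta>"
        using * \<open>\<delta> > 0\<close> emeasure_eq_measure2[OF m] by (simp add: ennreal_less_iff)
    qed
    have "\<exists>d>0. \<forall>y. \<bar>y - x\<bar> < d \<longrightarrow> norm (f y - f x) \<le> \<epsilon> * \<bar>y - x\<bar>" if "x \<notin> N" for x
    proof -
      have "(f has_derivative (\<lambda>h. 0)) (at x)"
        using that unfolding N_def has_vector_derivative_def by simp
      then show ?thesis
        using \<open>\<epsilon> > 0\<close> unfolding has_derivative_at_alt by (auto simp: bounded_linear_zero)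
    qed
    then obtain d where d: "\<And>x. x \<notin> N \<Longrightarrow> d x > 0"
        "\<And>x y. x \<notin> N \<Longrightarrow> \<bar>y - x\<bar> < d x \<Longrightarrow> norm (f y - f x) \<le> \<epsilon> * \<bar>y - x\<bar>"
      by metis
    define \<gamma> where "\<gamma> x = (if x \<in> N then V else ball x (d x))" for x
    have "gauge \<gamma>"
      unfolding gauge_def \<gamma>_def using V d by auto
    then obtain p where p: "p tagged_division_of {a..b}" "\<gamma> fine p"
      using fine_division_exists_real by blast
    define bad where "bad = {(x, K) \<in> p. x \<in> N}"
    have "finite p" using p(1) by blast
    have "bad \<subseteq> p" unfolding bad_def by auto
    have bad_part: "bad tagged_partial_division_of {a..b}"
      using tagged_partial_division_subset[OF _ \<open>bad \<subseteq> p\<close>] p(1) tagged_division_of_def by blast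
    have bad_tag: "bad tagged_division_of \<Union>(snd ` bad)"
      using tagged_partial_division_of_Union_self[OF bad_part] .
    have bad_div: "(snd ` bad) division_of \<Union>(snd ` bad)"
      using division_of_tagged_division[OF bad_tag] .
    have K: "\<exists>u v. K = {u..v} \<and> u \<le> x \<and> x \<le> v \<and> a \<le> u \<and> v \<le> b" if "(x, K) \<in> p" for x K
    proof -
      from that p(1) have "x \<in> K" "K \<subseteq> {a..b}" "\<exists>u v. K = cbox u v" by blast+
      then show ?thesis by fastforce
    qed
    have bad_le: "(\<Sum>(x, K)\<in>bad. norm (f (Sup K) - f (Inf K))) \<le> \<epsilon>"
    proof -
      have meas: "Sup K - Inf K = measure lebesgue K" if "K \<in> snd ` bad" for K
        using K \<open>bad \<subseteq> p\<close> that by fastforce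
      have "(\<Sum>K\<in>snd ` bad. Sup K - Inf K) = (\<Sum>K\<in>snd ` bad. measure lebesgue K)"
        using meas by (rule sum.cong[OF refl])
      also have "\<dots> = measure lebesgue (\<Union>(snd ` bad))"
        by (rule content_division[OF bad_div])
      also have "\<dots> \<le> measure lebesgue V"
      proof (rule measure_mono_fmeasurable)
        show "\<Union>(snd ` bad) \<subseteq> V"
        proof -
          have "K \<subseteq> V" if "(x, K) \<in> bad" for x K
            using that fineD[OF p(2), of x K] unfolding bad_def \<gamma>_def by simp
          then show ?thesis by (intro Union_least) (metis imageE prod.collapse)
        qed
        show "\<Union>(snd ` bad) \<in> sets lebesgue"
          using lmeasurable_division[OF bad_div] by auto
      qed (rule V_meas)
      finally have "(\<Sum>K\<in>snd ` bad. Sup K - Inf K) < \<delta>" using V_meas by simp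
      moreover have "\<Union>(snd ` bad) \<subseteq> {a..b}"
        using tagged_partial_division_ofD(3)[OF bad_part] by fastforce
      ultimately have "(\<Sum>K\<in>snd ` bad. norm (f (Sup K) - f (Inf K))) < \<epsilon>"
        using \<delta>[OF bad_div] by blast
      moreover have "(\<Sum>(x, K)\<in>bad. norm (f (Sup K) - f (Inf K))) = (\<Sum>K\<in>snd ` bad. norm (f (Sup K) - f (Inf K)))"
      proof -
        \<comment> \<open>empty intervals get the value 0, since \<open>Sup {}\<close> is unspecified\<close>
        let ?d = "\<lambda>K. if K = {} then 0 else norm (f (Sup K) - f (Inf K))"
        have "(\<Sum>(x, K)\<in>bad. ?d K) = (\<Sum>K\<in>snd ` bad. ?d K)"
        proof (rule sum.over_tagged_division_lemma[OF bad_tag])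
          fix u v :: real
          assume "box u v = {}"
          then show "?d (cbox u v) = 0"
            by (cases "u = v") auto
        qed
        moreover have nonempty: "K \<noteq> {}" if "(x, K) \<in> bad" for x K
          using K \<open>bad \<subseteq> p\<close> that by fastforce
        then have "(\<Sum>(x, K)\<in>bad. ?d K) = (\<Sum>(x, K)\<in>bad. norm (f (Sup K) - f (Inf K)))"
          by (intro sum.cong) auto
        moreover have "(\<Sum>K\<in>snd ` bad. ?d K) = (\<Sum>K\<in>snd ` bad. norm (f (Sup K) - f (Inf K)))"
          using nonempty by (intro sum.cong) auto
        ultimately show ?thesis by simp
      qed
      ultimately show ?thesis by simp
    qed
    have good_le: "(\<Sum>(x, K)\<in>p - bad. norm (f (Sup K) - f (Inf K))) \<le> \<epsilon> * (b - a)"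
    proof -
      have "norm (f (Sup K) - f (Inf K)) \<le> \<epsilon> * (Sup K - Inf K)" if "(x, K) \<in> p - bad" for x K
      proof -
        obtain u v where uv: "K = {u..v}" "u \<le> x" "x \<le> v" using K[of x K] \<open>(x, K) \<in> p - bad\<close> by auto
        have "x \<notin> N" "(x, K) \<in> p" using that unfolding bad_def by auto
        then have "K \<subseteq> ball x (d x)"
          using fineD[OF p(2), of x K] unfolding \<gamma>_def by simp
        moreover have "u \<in> K" "v \<in> K" using uv by auto
        ultimately have "u \<in> ball x (d x)" "v \<in> ball x (d x)" by blast+
        then have "norm (f u - f x) \<le> \<epsilon> * \<bar>u - x\<bar>" "norm (f v - f x) \<le> \<epsilon> * \<bar>v - x\<bar>"
          using d(2)[OF \<open>x \<notin> N\<close>] by (auto simp: dist_real_def abs_minus_commute)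
        moreover have "norm (f v - f u) \<le> norm (f v - f x) + norm (f u - f x)"
          using norm_triangle_ineq4[of "f v - f x" "f u - f x"] by simp
        ultimately show ?thesis using uv by (simp add: algebra_simps)
      qed
      then have "(\<Sum>(x, K)\<in>p - bad. norm (f (Sup K) - f (Inf K))) \<le> (\<Sum>(x, K)\<in>p - bad. \<epsilon> * (Sup K - Inf K))"
        by (intro sum_mono) auto
      also have "\<dots> \<le> (\<Sum>(x, K)\<in>p. \<epsilon> * (Sup K - Inf K))"
        using K \<open>finite p\<close> \<open>\<epsilon> > 0\<close> by (intro sum_mono2) fastforce+
      also have "\<dots> = \<epsilon> * b - \<epsilon> * a"
        using additive_tagged_division_1[OF \<open>a \<le> b\<close> p(1), of "\<lambda>x. \<epsilon> * x"] by (simp add: algebra_simps)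
      finally show ?thesis by (simp add: algebra_simps)
    qed
    have "norm (f b - f a) = norm (\<Sum>(x, K)\<in>p. f (Sup K) - f (Inf K))"
      using additive_tagged_division_1[OF \<open>a \<le> b\<close> p(1), of f] by simp
    also have "\<dots> \<le> (\<Sum>(x, K)\<in>p. norm (f (Sup K) - f (Inf K)))"
      by (rule order_trans[OF norm_sum]) (simp add: case_prod_unfold)
    also have "\<dots> = (\<Sum>(x, K)\<in>p - bad. norm (f (Sup K) - f (Inf K))) + (\<Sum>(x, K)\<in>bad. norm (f (Sup K) - f (Inf K)))"
      using \<open>finite p\<close> \<open>bad \<subseteq> p\<close> by (rule sum.subset_diff[rotated])
    finally show ?thesis using bad_le good_le by linarith
  qed
  have "norm (f b - f a) \<le> e" if "e > 0" for e
  proof -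
    define c where "c = b - a + 1"
    have "c > 0" using \<open>a \<le> b\<close> by (simp add: c_def)
    then have "norm (f b - f a) \<le> e / c * (c - 1) + e / c"
      using le[of "e / c"] that by (simp add: c_def)
    then show ?thesis using \<open>c > 0\<close> by (simp add: field_simps)
  qed
  then show ?thesis
    by (metis eq_iff_diff_eq_0 field_le_epsilon add_0 norm_le_zero_iff)
qed

lemma abs_continuous_zero_derivative_constant:
  assumes ac: "\<And>a b. abs_continuous_on {a..b} f"
    and der: "AE t in lebesgue. (f has_real_derivative 0) (at t)"
  shows "f s = f t"
proof -
  have "f a = f b" if "a \<le> b" for a b
    using that ac[of a b] der unfolding abs_continuous_on_def has_real_derivative_iff_has_vector_derivative
    by (intro zero_derivative_ae_imp_eq) auto
  then show ?thesis by (metis linear)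
qed

lemma lipschitz_zero_derivative_constant:
  fixes f :: "real \<Rightarrow> 'a::real_normed_vector"
  assumes lip: "\<And>a b. \<exists>C. C-lipschitz_on {a..b} f"
    and der: "AE t in lebesgue. (f has_vector_derivative 0) (at t)"
  shows "f s = f t"
proof -
  have "f a = f b" if "a \<le> b" for a b
  proof (rule zero_derivative_ae_imp_eq[OF that _ der])
    fix \<epsilon> :: real assume "\<epsilon> > 0"
    obtain C where C: "C-lipschitz_on {a..b} f" using lip by blast
    have "C \<ge> 0" using lipschitz_on_nonneg[OF C] .
    \<comment> \<open>\<open>C + 1\<close> in place of \<open>C\<close>, which may be 0\<close>
    have "(\<Sum>K\<in>D. norm (f (Sup K) - f (Inf K))) < \<epsilon>"
      if D: "D division_of \<Union>D" "\<Union>D \<subseteq> {a..b}" "(\<Sum>K\<in>D. Sup K - Inf K) < \<epsilon> / (C + 1)" for D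
    proof -
      have "norm (f (Sup K) - f (Inf K)) \<le> C * (Sup K - Inf K)" if "K \<in> D" for K
      proof -
        obtain u v where "K = {u..v}" "u \<le> v"
          using division_ofD(3)[OF D(1)] division_ofD(4)[OF D(1)] \<open>K \<in> D\<close>
          by (metis box_real(2) atLeastatMost_empty_iff)
        moreover from this have "{u..v} \<subseteq> {a..b}" using D(2) that by blast
        moreover from this have "u \<in> {a..b}" "v \<in> {a..b}" using \<open>u \<le> v\<close> by auto
        ultimately show ?thesis using lipschitz_onD[OF C, of v u] by (simp add: dist_norm)
      qed
      then have "(\<Sum>K\<in>D. norm (f (Sup K) - f (Inf K))) \<le> C * (\<Sum>K\<in>D. Sup K - Inf K)"
        unfolding sum_distrib_left by (rule sum_mono)
      also have "\<dots> \<le> C * (\<epsilon> / (C + 1))"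
        using D(3) \<open>C \<ge> 0\<close> by (intro mult_left_mono) auto
      also have "\<dots> < \<epsilon>" using \<open>C \<ge> 0\<close> \<open>\<epsilon> > 0\<close> by (simp add: field_simps)
      finally show ?thesis .
    qed
    then show "\<exists>\<delta>>0. \<forall>D. D division_of \<Union>D \<and> \<Union>D \<subseteq> {a..b} \<and> (\<Sum>K\<in>D. Sup K - Inf K) < \<delta>
        \<longrightarrow> (\<Sum>K\<in>D. norm (f (Sup K) - f (Inf K))) < \<epsilon>"
      using \<open>C \<ge> 0\<close> \<open>\<epsilon> > 0\<close> by (intro exI[of _ "\<epsilon> / (C + 1)"]) auto
  qed
  then show ?thesis by (metis linear)
qed

text \<open>Absolute continuity is applied to divisions consisting of a single interval.\<close>

lemma abs_continuous_imp_continuous: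
  fixes f :: "real \<Rightarrow> real"
  assumes ac: "\<And>a b. abs_continuous_on {a..b} f"
  shows "continuous_on UNIV f"
  unfolding continuous_on_iff
proof (intro ballI allI impI)
  fix x e :: real assume "e > 0"
  with ac[of "x - 1" "x + 1", unfolded abs_continuous_on_def]
  obtain \<delta> where "\<delta> > 0" and \<delta>: "\<forall>D. D division_of \<Union>D \<and> \<Union>D \<subseteq> {x - 1..x + 1} \<and>
      (\<Sum>K\<in>D. Sup K - Inf K) < \<delta> \<longrightarrow> (\<Sum>K\<in>D. \<bar>f (Sup K) - f (Inf K)\<bar>) < e"
    by meson
  have *: "\<bar>f v - f u\<bar> < e" if "u \<le> v" "x - 1 \<le> u" "v \<le> x + 1" "v - u < \<delta>" for u v
  proof -
    have "{{u..v}} division_of \<Union>{{u..v}}" using division_of_self[of u v] \<open>u \<le> v\<close> by simp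
    moreover have "\<Union>{{u..v}} \<subseteq> {x - 1..x + 1}" using that by simp
    moreover have "(\<Sum>K\<in>{{u..v}}. Sup K - Inf K) < \<delta>" using that by simp
    ultimately have "(\<Sum>K\<in>{{u..v}}. \<bar>f (Sup K) - f (Inf K)\<bar>) < e" using \<delta>[rule_format, of "{{u..v}}"] by blast
    then show ?thesis using \<open>u \<le> v\<close> by simp
  qed
  show "\<exists>d>0. \<forall>y\<in>UNIV. dist y x < d \<longrightarrow> dist (f y) (f x) < e"
  proof (intro exI[of _ "min \<delta> 1"] conjI ballI impI)
    fix y assume "dist y x < min \<delta> 1"
    then show "dist (f y) (f x) < e"
      using *[of x y] *[of y x] by (cases "x \<le> y") (auto simp: dist_real_def abs_minus_commute)
  qed (use \<open>\<delta> > 0\<close> in auto)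
qed

text \<open>The set where a continuous function differs from a constant is open, and a nonempty open set is
  not null.\<close>

lemma continuous_ae_constant_imp_constant:
  fixes f :: "real \<Rightarrow> real"
  assumes "continuous_on UNIV f" and "AE t in lebesgue. f t = c"
  shows "f t = c"
proof (rule ccontr)
  assume "f t \<noteq> c"
  have "open {t. f t \<noteq> c}"
    using assms(1) by (intro open_Collect_neq) auto
  moreover have "negligible {t. f t \<noteq> c}"
    using assms(2) by (simp add: completion.AE_iff_null_sets negligible_iff_null_sets)
  ultimately show False using \<open>f t \<noteq> c\<close> open_not_negligible by blast
qed

lemma AE_lebesgue_obtain:
  assumes "AE t in lebesgue. P (t::real)"
  obtains t where "P t"
proof -
  have "ae_filter (lebesgue :: real measure) \<noteq> bot"
    by (simp add: ae_filter_eq_bot_iff)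
  then show ?thesis using eventually_happens'[OF _ assms] that by blast
qed

section \<open>The matrix exponential\<close>

text \<open>Gives the product rule, continuity and interchange with series for matrix products.\<close>

lemma bounded_bilinear_matrix_mult:
  "bounded_bilinear ((**) :: complex^2^2 \<Rightarrow> complex^2^2 \<Rightarrow> complex^2^2)"
  unfolding bilinear_conv_bounded_bilinear[symmetric] bilinear_def
  by (auto intro!: linearI simp: matrix_matrix_mult_def vec_eq_iff sum_2 algebra_simps)

interpretation matrix_mult: bounded_bilinear "(**) :: complex^2^2 \<Rightarrow> complex^2^2 \<Rightarrow> complex^2^2"
  by (rule bounded_bilinear_matrix_mult)

text \<open>Term-by-term differentiation of scalar power series, applied to each coordinate.\<close>

lemma power_series_has_vector_derivative:
  fixes V :: "nat \<Rightarrow> 'a::euclidean_space"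
  assumes V: "\<And>t::real. summable (\<lambda>n. t ^ n *\<^sub>R V n)"
    and V': "summable (\<lambda>n. t ^ n *\<^sub>R (real (Suc n) *\<^sub>R V (Suc n)))"
  shows "((\<lambda>t. \<Sum>n. t ^ n *\<^sub>R V n) has_vector_derivative
    (\<Sum>n. t ^ n *\<^sub>R (real (Suc n) *\<^sub>R V (Suc n)))) (at t)"
  unfolding has_vector_derivative_def
proof (subst has_derivative_componentwise_within, intro ballI)
  fix b :: 'a assume "b \<in> Basis"
  have "summable (\<lambda>n. (V n \<bullet> b) * y ^ n)" for y
    using bounded_linear.summable[OF bounded_linear_inner_left V] by (simp add: mult.commute)
  then have "((\<lambda>t. \<Sum>n. (V n \<bullet> b) * t ^ n) has_field_derivative (\<Sum>n. diffs (\<lambda>n. V n \<bullet> b) n * t ^ n)) (at t)"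
    by (rule termdiffs_strong_converges_everywhere)
  moreover have "(\<Sum>n. (V n \<bullet> b) * y ^ n) = (\<Sum>n. y ^ n *\<^sub>R V n) \<bullet> b" for y
    using bounded_linear.suminf[OF bounded_linear_inner_left V] by (simp add: mult.commute)
  moreover have "(\<Sum>n. diffs (\<lambda>n. V n \<bullet> b) n * t ^ n) = (\<Sum>n. t ^ n *\<^sub>R (real (Suc n) *\<^sub>R V (Suc n))) \<bullet> b"
    using bounded_linear.suminf[OF bounded_linear_inner_left V', of b] by (simp add: diffs_def mult_ac)
  ultimately show "((\<lambda>t. (\<Sum>n. t ^ n *\<^sub>R V n) \<bullet> b) has_derivative
      (\<lambda>x. (x *\<^sub>R (\<Sum>n. t ^ n *\<^sub>R (real (Suc n) *\<^sub>R V (Suc n)))) \<bullet> b)) (at t)"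
    by (simp add: has_field_derivative_def mult_commute_abs mult.commute)
qed

text \<open>Turns the exponential series along a line into a power series in \<open>t\<close> with matrix coefficients.\<close>

lemma matrix_exp_term:
  fixes X :: "complex^2^2"
  shows "(1 / fact n) *\<^sub>R (((**) (t *\<^sub>R X) ^^ n) (mat 1))
    = t ^ n *\<^sub>R ((1 / fact n) *\<^sub>R (((**) X ^^ n) (mat 1)))"
proof -
  have "((**) (t *\<^sub>R X) ^^ n) (mat 1) = t ^ n *\<^sub>R (((**) X ^^ n) (mat 1))"
  proof (induction n)
    case (Suc n)
    have "((**) (t *\<^sub>R X) ^^ Suc n) (mat 1) = (t *\<^sub>R X) ** (t ^ n *\<^sub>R (((**) X ^^ n) (mat 1)))"
      unfolding funpow.simps o_apply Suc.IH ..
    also have "\<dots> = t ^ Suc n *\<^sub>R (((**) X ^^ Suc n) (mat 1))"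
      by (simp add: matrix_mult.scaleR_left matrix_mult.scaleR_right)
    finally show ?case .
  qed simp
  then show ?thesis by simp
qed

lemma matrix_exp_term_summable:
  fixes X :: "complex^2^2"
  shows "summable (\<lambda>n. t ^ n *\<^sub>R ((1 / fact n) *\<^sub>R (((**) X ^^ n) (mat 1 :: complex^2^2))))"
proof -
  obtain K where "K > 0" and K: "\<And>A B. norm (A ** B :: complex^2^2) \<le> norm (A :: complex^2^2) * norm (B :: complex^2^2) * K"
    using matrix_mult.pos_bounded by blast
  have pow: "norm (((**) X ^^ n) (mat 1)) \<le> norm (mat 1 :: complex^2^2) * (norm X * K) ^ n" for n
  proof (induction n)
    case (Suc n)
    have "norm (((**) X ^^ Suc n) (mat 1)) \<le> norm (((**) X ^^ n) (mat 1)) * (norm X * K)"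
      using K[of X "((**) X ^^ n) (mat 1)"] by (simp add: mult_ac)
    also have "\<dots> \<le> norm (mat 1 :: complex^2^2) * (norm X * K) ^ n * (norm X * K)"
      using \<open>K > 0\<close> by (intro mult_right_mono[OF Suc.IH]) auto
    finally show ?case by (simp add: mult_ac)
  qed simp
  have "summable (\<lambda>n. norm (mat 1 :: complex^2^2) * ((\<bar>t\<bar> * (norm X * K)) ^ n / fact n))"
    using summable_exp[of "\<bar>t\<bar> * (norm X * K)"]
    by (intro summable_mult) (simp add: field_simps)
  then show ?thesis
  proof (rule summable_comparison_test'[where N = 0])
    fix n :: nat
    have "norm (t ^ n *\<^sub>R ((1 / fact n) *\<^sub>R (((**) X ^^ n) (mat 1 :: complex^2^2))))
        = \<bar>t\<bar> ^ n / fact n * norm (((**) X ^^ n) (mat 1))"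
      by (simp add: power_abs)
    also have "\<dots> \<le> \<bar>t\<bar> ^ n / fact n * (norm (mat 1 :: complex^2^2) * (norm X * K) ^ n)"
      by (intro mult_left_mono pow) auto
    finally show "norm (t ^ n *\<^sub>R ((1 / fact n) *\<^sub>R (((**) X ^^ n) (mat 1 :: complex^2^2))))
        \<le> norm (mat 1 :: complex^2^2) * ((\<bar>t\<bar> * (norm X * K)) ^ n / fact n)"
      by (simp add: power_mult_distrib mult_ac)
  qed
qed

lemma matrix_exp_series:
  "matrix_exp (t *\<^sub>R X) = (\<Sum>n. t ^ n *\<^sub>R ((1 / fact n) *\<^sub>R (((**) X ^^ n) (mat 1))))"
  unfolding matrix_exp_def by (simp only: matrix_exp_term)

lemma matrix_exp_0 [simp]: "matrix_exp 0 = mat 1"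
proof -
  have "(\<Sum>n. 0 ^ n *\<^sub>R ((1 / fact n) *\<^sub>R (((**) 0 ^^ n) (mat 1)))) = (mat 1 :: complex^2^2)"
    by (subst suminf_finite[of "{0}"]) auto
  then show ?thesis using matrix_exp_series[of 0 0] by simp
qed

lemma matrix_exp_commute: "X ** matrix_exp (t *\<^sub>R X) = matrix_exp (t *\<^sub>R X) ** X"
proof -
  have "X ** (((**) X ^^ n) (mat 1)) = (((**) X ^^ n) (mat 1)) ** X" for n
  proof (induction n)
    case (Suc n)
    have "X ** (((**) X ^^ Suc n) (mat 1)) = X ** (((((**) X ^^ n) (mat 1))) ** X)"
      by (simp add: Suc.IH)
    then show ?case by (simp add: matrix_mul_assoc)
  qed simp
  then show ?thesis
    unfolding matrix_exp_series
      bounded_linear.suminf[OF matrix_mult.bounded_linear_left matrix_exp_term_summable]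
      bounded_linear.suminf[OF matrix_mult.bounded_linear_right matrix_exp_term_summable]
    by (simp only: matrix_mult.scaleR_left matrix_mult.scaleR_right)
qed

lemma matrix_exp_has_vector_derivative:
  "((\<lambda>t. matrix_exp (t *\<^sub>R X)) has_vector_derivative X ** matrix_exp (t *\<^sub>R X)) (at t)"
proof -
  define V where "V n = (1 / fact n) *\<^sub>R (((**) X ^^ n) (mat 1))" for n
  have V: "real (Suc n) *\<^sub>R V (Suc n) = X ** V n" for n
    by (simp add: V_def matrix_mult.scaleR_right field_simps del: of_nat_Suc)
  have sm: "summable (\<lambda>n. t ^ n *\<^sub>R V n)" for t
    unfolding V_def by (rule matrix_exp_term_summable)
  have "summable (\<lambda>n. t ^ n *\<^sub>R (X ** V n))" "X ** (\<Sum>n. t ^ n *\<^sub>R V n) = (\<Sum>n. t ^ n *\<^sub>R (X ** V n))"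
    using bounded_linear.summable[OF matrix_mult.bounded_linear_right sm[of t], of X]
      bounded_linear.suminf[OF matrix_mult.bounded_linear_right sm[of t], of X]
    by (simp_all add: matrix_mult.scaleR_right)
  then show ?thesis
    using power_series_has_vector_derivative[of V t] sm
    unfolding matrix_exp_series V V_def[symmetric] by simp
qed

lemma lipschitz_on_matrix_mult:
  fixes f g :: "real \<Rightarrow> complex^2^2"
  assumes f: "\<exists>C. C-lipschitz_on {a..b} f" and g: "\<exists>C. C-lipschitz_on {a..b} g"
  shows "\<exists>C. C-lipschitz_on {a..b} (\<lambda>t. f t ** g t)"
proof -
  obtain C D where C: "C-lipschitz_on {a..b} f" and D: "D-lipschitz_on {a..b} g" using f g by blast
  have nn: "C \<ge> 0" "D \<ge> 0" using C D lipschitz_on_nonneg by blast+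
  have bdd: "\<exists>B>0. \<forall>t\<in>{a..b}. norm (h t) \<le> B" if "E-lipschitz_on {a..b} h" for E and h :: "real \<Rightarrow> complex^2^2"
  proof -
    have "bounded (h ` {a..b})"
      using lipschitz_on_continuous_on[OF that] compact_continuous_image compact_imp_bounded compact_Icc by metis
    then show ?thesis unfolding bounded_pos by auto
  qed
  obtain P Q where PQ: "P > 0" "Q > 0" "\<And>t. t \<in> {a..b} \<Longrightarrow> norm (f t) \<le> P" "\<And>t. t \<in> {a..b} \<Longrightarrow> norm (g t) \<le> Q"
    using bdd[OF C] bdd[OF D] by blast
  obtain K where "K > 0" and K: "\<And>A B. norm (A ** B :: complex^2^2) \<le> norm (A :: complex^2^2) * norm (B :: complex^2^2) * K"
    using matrix_mult.pos_bounded by blast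
  have "((C * Q + P * D) * K)-lipschitz_on {a..b} (\<lambda>t. f t ** g t)"
  proof (rule lipschitz_onI)
    fix s t assume st: "s \<in> {a..b}" "t \<in> {a..b}"
    have "f s ** g s - f t ** g t = (f s - f t) ** g s + f t ** (g s - g t)"
      by (simp add: matrix_mult.diff_left matrix_mult.diff_right)
    then have "norm (f s ** g s - f t ** g t) \<le> norm (f s - f t) * norm (g s) * K + norm (f t) * norm (g s - g t) * K"
      using norm_triangle_ineq[of "(f s - f t) ** g s" "f t ** (g s - g t)"]
        K[of "f s - f t" "g s"] K[of "f t" "g s - g t"] by simp
    also have "\<dots> \<le> (C * dist s t) * Q * K + P * (D * dist s t) * K"
      using lipschitz_onD[OF C st] lipschitz_onD[OF D st] PQ st \<open>K > 0\<close> nn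
      by (intro add_mono mult_right_mono mult_mono) (auto simp: dist_norm)
    finally show "dist (f s ** g s) (f t ** g t) \<le> (C * Q + P * D) * K * dist s t"
      by (simp add: dist_norm algebra_simps)
  qed (use nn PQ \<open>K > 0\<close> in auto)
  then show ?thesis by blast
qed

lemma matrix_exp_lipschitz: "\<exists>C. C-lipschitz_on {a..b} (\<lambda>t. matrix_exp (t *\<^sub>R X))"
proof -
  let ?E = "\<lambda>t. matrix_exp (t *\<^sub>R X)"
  have cont: "continuous_on {a..b} ?E"
    using matrix_exp_has_vector_derivative has_vector_derivative_continuous
    by (intro continuous_at_imp_continuous_on) blast
  then have "continuous_on {a..b} (\<lambda>t. X ** ?E t)"
    by (intro matrix_mult.continuous_on continuous_intros)
  then have "bounded ((\<lambda>t. X ** ?E t) ` {a..b})"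
    by (intro compact_imp_bounded compact_continuous_image) auto
  then obtain B where "B > 0" and B: "\<And>t. t \<in> {a..b} \<Longrightarrow> norm (X ** ?E t) \<le> B"
    unfolding bounded_pos by auto
  have "B-lipschitz_on {a..b} ?E"
  proof (rule bounded_derivative_imp_lipschitz)
    fix t assume "t \<in> {a..b}"
    show "(?E has_derivative (\<lambda>h. h *\<^sub>R (X ** ?E t))) (at t within {a..b})"
      using matrix_exp_has_vector_derivative[of X t] has_derivative_at_withinI
      unfolding has_vector_derivative_def by blast
    show "onorm (\<lambda>h. h *\<^sub>R (X ** ?E t)) \<le> B"
      using mult_left_mono[OF B[OF \<open>t \<in> {a..b}\<close>] abs_ge_zero] by (intro onorm_le) (simp add: mult.commute)
  qed (use \<open>B > 0\<close> in auto)
  then show ?thesis by blast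
qed

text \<open>Multiplication on the right by \<open>matrix_exp (- t *\<^sub>R X)\<close> makes the derivative vanish almost
  everywhere, so the product is constant. The same applies to \<open>matrix_exp (t *\<^sub>R X)\<close> in place of \<open>g\<close>,
  which shows that the two exponentials are inverse to each other.\<close>

lemma lipschitz_solution_eq_matrix_exp:
  fixes g :: "real \<Rightarrow> complex^2^2"
  assumes lip: "\<And>a b. \<exists>C. C-lipschitz_on {a..b} g"
    and der: "AE t in lebesgue. (g has_vector_derivative g t ** X) (at t)"
  shows "g t = g 0 ** matrix_exp (t *\<^sub>R X)"
proof -
  let ?E = "\<lambda>t. matrix_exp (t *\<^sub>R X)"
  let ?F = "\<lambda>t. matrix_exp (t *\<^sub>R (- X))"
  have const: "f t ** ?F t = f 0"
    if lip: "\<And>a b. \<exists>C. C-lipschitz_on {a..b} f"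
    and der: "AE t in lebesgue. (f has_vector_derivative f t ** X) (at t)" for f :: "real \<Rightarrow> complex^2^2" and t
  proof -
    have "AE t in lebesgue. ((\<lambda>t. f t ** ?F t) has_vector_derivative 0) (at t)"
      using der
    proof eventually_elim
      case (elim t)
      have "((\<lambda>t. f t ** ?F t) has_vector_derivative f t ** (- X ** ?F t) + f t ** X ** ?F t) (at t)"
        by (rule matrix_mult.has_vector_derivative[OF elim matrix_exp_has_vector_derivative])
      then show ?case
        by (simp add: matrix_mult.minus_left matrix_mult.minus_right matrix_mul_assoc)
    qed
    then have "f t ** ?F t = f 0 ** ?F 0"
      by (intro lipschitz_zero_derivative_constant[where f = "\<lambda>t. f t ** ?F t"] lipschitz_on_matrix_mult
          lip matrix_exp_lipschitz)
    then show ?thesis by simp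
  qed
  have "?E t ** ?F t = mat 1"
    using const[of ?E] matrix_exp_lipschitz matrix_exp_has_vector_derivative[of X]
    by (simp add: matrix_exp_commute)
  then have "?F t ** ?E t = mat 1" by (simp add: matrix_left_right_inverse)
  then have "g t = g t ** ?F t ** ?E t" by (simp add: matrix_mul_assoc[symmetric])
  then show ?thesis using const[OF lip der] by simp
qed

section \<open>The Lie algebra and the pseudoscalar product\<close>

lemmas matrix_entries = vec_eq_iff forall_2 matrix_matrix_mult_def sum_2 mat_def

lemma herm_coord_linear:
  "herm_coord e (v + w) = herm_coord e v + herm_coord e w"
  "herm_coord e (v - w) = herm_coord e v - herm_coord e w"
  "herm_coord e (a *\<^sub>R v) = a * herm_coord e v"
  "herm_coord e 0 = 0"
  by (simp_all add: herm_coord_def inner_simps)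

lemma Herm_combination: "a *\<^sub>R e0 + b *\<^sub>R e1 + c *\<^sub>R e2 + d *\<^sub>R e3 \<in> Herm"
  unfolding Herm_def by (intro span_add span_scale span_base) auto

lemma e_in_Herm: "e0 \<in> Herm" "e1 \<in> Herm" "e2 \<in> Herm" "e3 \<in> Herm"
  unfolding Herm_def by (intro span_base; simp)+

lemma Herm_subspace: "subspace Herm"
  unfolding Herm_def by (rule subspace_span)

lemma gl_plus_subspace: "subspace gl_plus"
proof (rule subspaceI)
  show "c *\<^sub>R v \<in> gl_plus" if "v \<in> gl_plus" for c v
  proof -
    have "trace (c *\<^sub>R v) = c *\<^sub>R trace v"
      by (simp add: trace_def sum_2 scaleR_add_right)
    then show ?thesis using that by (simp add: gl_plus_def scaleR_conv_of_real[where 'a = complex])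
  qed
qed (simp_all add: gl_plus_def trace_add, simp add: trace_def)

lemma Herm_subset_gl_plus: "Herm \<subseteq> gl_plus"
  unfolding Herm_def
  by (intro span_minimal gl_plus_subspace)
    (simp add: gl_plus_def trace_def sum_2 complex_is_Real_iff e0_def e1_def e2_def e3_def)

lemma i_e_in_gl_plus: "mat \<i> ** e1 \<in> gl_plus" "mat \<i> ** e2 \<in> gl_plus" "mat \<i> ** e3 \<in> gl_plus"
  by (simp_all add: gl_plus_def trace_def matrix_entries complex_is_Real_iff e1_def e2_def e3_def)

text \<open>The Cartan decomposition of \<open>gl_plus\<close> into Herm and the skew-Hermitian traceless matrices, whose
  basis is \<open>i e1, i e2, i e3\<close>. Multiplication by \<open>-i\<close> turns the skew-Hermitian coefficients into
  Hermitian ones; this is the role of \<open>mat (- \<i>)\<close> here and below.\<close>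

lemma gl_plus_expansion:
  assumes "w \<in> gl_plus"
  shows "w = herm_coord e0 w *\<^sub>R e0 + herm_coord e1 w *\<^sub>R e1 + herm_coord e2 w *\<^sub>R e2
      + herm_coord e3 w *\<^sub>R e3 + herm_coord e1 (mat (- \<i>) ** w) *\<^sub>R (mat \<i> ** e1)
      + herm_coord e2 (mat (- \<i>) ** w) *\<^sub>R (mat \<i> ** e2)
      + herm_coord e3 (mat (- \<i>) ** w) *\<^sub>R (mat \<i> ** e3)"
  using assms unfolding herm_coord_e
  by (simp add: gl_plus_def trace_def matrix_entries complex_is_Real_iff complex_eq_iff
      e0_def e1_def e2_def e3_def add_divide_distrib diff_divide_distrib)

text \<open>With \<open>e1, e2, e3\<close> as a basis of \<open>\<real>\<^sup>3\<close>, the bracket of two Hermitian matrices is \<open>-i\<close> times the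
  cross product of their traceless parts. In particular it is skew-Hermitian, and it vanishes
  exactly when the traceless parts are parallel.\<close>

lemma lie_bracket_Herm_e:
  assumes "u \<in> Herm"
  shows "lie_bracket u e0 = 0"
    "lie_bracket u e1 = herm_coord e2 u *\<^sub>R (mat \<i> ** e3) - herm_coord e3 u *\<^sub>R (mat \<i> ** e2)"
    "lie_bracket u e2 = herm_coord e3 u *\<^sub>R (mat \<i> ** e1) - herm_coord e1 u *\<^sub>R (mat \<i> ** e3)"
    "lie_bracket u e3 = herm_coord e1 u *\<^sub>R (mat \<i> ** e2) - herm_coord e2 u *\<^sub>R (mat \<i> ** e1)"
proof -
  obtain a b c d where u: "u = a *\<^sub>R e0 + b *\<^sub>R e1 + c *\<^sub>R e2 + d *\<^sub>R e3"
    using Herm_expansion[OF assms] by blast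
  note defs = lie_bracket_def matrix_entries complex_eq_iff e0_def e1_def e2_def e3_def
  show "lie_bracket u e0 = 0"
    "lie_bracket u e1 = herm_coord e2 u *\<^sub>R (mat \<i> ** e3) - herm_coord e3 u *\<^sub>R (mat \<i> ** e2)"
    "lie_bracket u e2 = herm_coord e3 u *\<^sub>R (mat \<i> ** e1) - herm_coord e1 u *\<^sub>R (mat \<i> ** e3)"
    "lie_bracket u e3 = herm_coord e1 u *\<^sub>R (mat \<i> ** e2) - herm_coord e2 u *\<^sub>R (mat \<i> ** e1)"
    unfolding u herm_coord_combination by (simp_all add: defs field_simps)
qed

lemma lie_bracket_i:
  "lie_bracket u (mat \<i> ** v) = mat \<i> ** lie_bracket u v"
  by (simp add: lie_bracket_def matrix_entries algebra_simps)

text \<open>Multiplying the bracket of Herm with itself by \<open>i\<close> leads back to Herm.\<close>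

lemma lie_bracket_Herm_i_e:
  assumes "u \<in> Herm"
  shows "lie_bracket u (mat \<i> ** e1) \<in> Herm" "lie_bracket u (mat \<i> ** e2) \<in> Herm"
    "lie_bracket u (mat \<i> ** e3) \<in> Herm"
proof -
  have "mat \<i> ** (a *\<^sub>R (mat \<i> ** v) - b *\<^sub>R (mat \<i> ** w)) = b *\<^sub>R w - a *\<^sub>R v"
    for a b and v w :: "complex^2^2"
    by (simp add: matrix_entries complex_eq_iff)
  then show "lie_bracket u (mat \<i> ** e1) \<in> Herm" "lie_bracket u (mat \<i> ** e2) \<in> Herm"
    "lie_bracket u (mat \<i> ** e3) \<in> Herm"
    unfolding lie_bracket_i lie_bracket_Herm_e[OF assms]
    by (simp_all add: subspace_diff[OF Herm_subspace] subspace_scale[OF Herm_subspace] e_in_Herm)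
qed

lemma pseudo_inner_e0: "pseudo_inner u e0 = herm_coord e0 u"
  using herm_coord_combination[of 1 0 0 0] by (simp add: pseudo_inner_def)

lemma pseudo_inner_perturb:
  "pseudo_inner (u + \<epsilon> *\<^sub>R h) (u + \<epsilon> *\<^sub>R h)
    = pseudo_inner u u + 2 * \<epsilon> * pseudo_inner u h + \<epsilon>\<^sup>2 * pseudo_inner h h"
  by (simp add: pseudo_inner_def herm_coord_linear power2_eq_square algebra_simps)

lemma covector_linear:
  assumes "covector f"
  shows "v \<in> gl_plus \<Longrightarrow> w \<in> gl_plus \<Longrightarrow> f (v + w) = f v + f w"
    and "v \<in> gl_plus \<Longrightarrow> w \<in> gl_plus \<Longrightarrow> f (v - w) = f v - f w"
    and "v \<in> gl_plus \<Longrightarrow> f (a *\<^sub>R v) = a * f v"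
    and "f 0 = 0"
proof -
  have *: "f (a *\<^sub>R v + b *\<^sub>R w) = a * f v + b * f w" if "v \<in> gl_plus" "w \<in> gl_plus" for v w a b
    using assms that unfolding covector_def by blast
  show "f (v + w) = f v + f w" if "v \<in> gl_plus" "w \<in> gl_plus"
    using *[OF that, of 1 1] by simp
  show "f (v - w) = f v - f w" if "v \<in> gl_plus" "w \<in> gl_plus"
    using *[OF that, of 1 "- 1"] by simp
  show "f (a *\<^sub>R v) = a * f v" if "v \<in> gl_plus"
    using *[OF that that, of a 0] by simp
  have "0 \<in> gl_plus" using gl_plus_subspace by (rule subspace_0)
  then show "f 0 = 0" using *[of 0 0 0 0] by simp
qed

text \<open>The Legendre correspondence of the problem. By homogeneity, minimality of \<open>f\<close> at \<open>u\<close> says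
  \<open>f v \<ge> f u * sqrt (pseudo_inner v v)\<close> on the open future cone. Along the line \<open>u + \<epsilon> *\<^sub>R h\<close>, which
  stays in the cone for small \<open>\<epsilon>\<close>, the gap \<open>F\<close> between the two sides is smallest at \<open>\<epsilon> = 0\<close>, and its
  vanishing derivative there is the claim. The abnormal case \<open>f u = 0\<close> is included: then \<open>f\<close>
  vanishes on Herm.\<close>

lemma minimizing_covector_on_Herm:
  assumes f: "covector f" and min: "is_arg_min f (\<lambda>v. v \<in> U_set) u"
    and unit: "pseudo_inner u u = 1" and h: "h \<in> Herm"
  shows "f h = f u * pseudo_inner u h"
proof -
  have u: "u \<in> Herm" "herm_coord e0 u > 0"
    using min unfolding is_arg_min_def U_set_def by (auto simp: pseudo_inner_e0)
  have gl: "u \<in> gl_plus" "h \<in> gl_plus" using u h Herm_subset_gl_plus by auto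
  have min_le: "f u \<le> f v" if "v \<in> U_set" for v
    using min that unfolding is_arg_min_def by (meson not_le)
  \<comment> \<open>pseudoscalar square and time coordinate of \<open>u + \<epsilon> *\<^sub>R h\<close>\<close>
  define q where "q \<epsilon> = 1 + 2 * \<epsilon> * pseudo_inner u h + \<epsilon>\<^sup>2 * pseudo_inner h h" for \<epsilon>
  define r where "r \<epsilon> = herm_coord e0 u + \<epsilon> * herm_coord e0 h" for \<epsilon>
  define F where "F \<epsilon> = f u + \<epsilon> * f h - f u * sqrt (q \<epsilon>)" for \<epsilon>
  have "isCont q 0" "isCont r 0" unfolding q_def r_def by (intro continuous_intros)+
  then have "\<forall>\<^sub>F \<epsilon> in at 0. q \<epsilon> > 0 \<and> r \<epsilon> > 0"
    using order_tendstoD(1)[of q "q 0" "at 0" 0] order_tendstoD(1)[of r "r 0" "at 0" 0] u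
    by (auto simp: isCont_def q_def r_def intro: eventually_conj)
  then obtain \<delta> where "\<delta> > 0" and \<delta>: "\<And>\<epsilon>. \<epsilon> \<noteq> 0 \<Longrightarrow> \<bar>\<epsilon>\<bar> < \<delta> \<Longrightarrow> q \<epsilon> > 0 \<and> r \<epsilon> > 0"
    unfolding eventually_at by (auto simp: dist_real_def)
  have pos: "q \<epsilon> > 0 \<and> r \<epsilon> > 0" if "\<bar>\<epsilon>\<bar> < \<delta>" for \<epsilon>
    using \<delta>[of \<epsilon>] that u by (cases "\<epsilon> = 0") (auto simp: q_def r_def)
  have "F 0 \<le> F \<epsilon>" if "\<bar>\<epsilon>\<bar> < \<delta>" for \<epsilon>
  proof -
    define v where "v = u + \<epsilon> *\<^sub>R h"
    have v: "v \<in> Herm" "v \<in> gl_plus" "f v = f u + \<epsilon> * f h"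
      unfolding v_def using u h gl
      by (auto intro: subspace_add subspace_scale Herm_subspace gl_plus_subspace
          simp: covector_linear[OF f] subspace_scale[OF gl_plus_subspace])
    have q: "pseudo_inner v v = q \<epsilon>" and r: "herm_coord e0 v = r \<epsilon>"
      unfolding v_def by (simp_all add: pseudo_inner_perturb unit q_def r_def herm_coord_linear)
    \<comment> \<open>the factor that scales \<open>v\<close> to a unit vector, where minimality applies\<close>
    define s where "s = sqrt (q \<epsilon>)"
    have s: "s > 0" "s\<^sup>2 = q \<epsilon>" using pos[OF that] by (simp_all add: s_def)
    have "pseudo_inner ((1 / s) *\<^sub>R v) ((1 / s) *\<^sub>R v) = pseudo_inner v v / s\<^sup>2"
      by (simp add: pseudo_inner_def herm_coord_linear power2_eq_square diff_divide_distrib)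
    then have "(1 / s) *\<^sub>R v \<in> U_set"
      using v s q r pos[OF that]
      by (auto simp: U_set_def pseudo_inner_e0 herm_coord_linear intro: subspace_scale Herm_subspace)
    from min_le[OF this] have "f u \<le> f v / s" by (simp add: covector_linear[OF f] v)
    then have "f u * s \<le> f v" using s by (simp add: field_simps)
    then show ?thesis unfolding F_def s_def[symmetric] v by (simp add: q_def)
  qed
  moreover have "(F has_real_derivative f h - f u * pseudo_inner u h) (at 0)"
    unfolding F_def q_def by (auto intro!: derivative_eq_intros)
  ultimately have "f h - f u * pseudo_inner u h = 0"
    using \<open>\<delta> > 0\<close> by (intro DERIV_local_min[of F _ 0 \<delta>]) auto
  then show ?thesis by simp
qed

text \<open>The sum of squares added below comes from Lagrange's identity for the spatial parts, of which
  \<open>(b, c, d)\<close> belongs to \<open>X\<close>.\<close>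

lemma reversed_Cauchy_Schwarz:
  assumes "X \<in> Herm" "pseudo_inner X X = 1" "herm_coord e0 X > 0" and v: "v \<in> U_set"
  shows "pseudo_inner X v \<ge> 1"
proof -
  obtain a b c d where X: "herm_coord e0 X = a" "herm_coord e1 X = b" "herm_coord e2 X = c" "herm_coord e3 X = d"
    by blast
  obtain a' b' c' d' where V: "herm_coord e0 v = a'" "herm_coord e1 v = b'" "herm_coord e2 v = c'" "herm_coord e3 v = d'"
    by blast
  have X1: "a\<^sup>2 = 1 + (b\<^sup>2 + c\<^sup>2 + d\<^sup>2)" "a > 0"
    using assms X by (simp_all add: pseudo_inner_def power2_eq_square)
  have v1: "a'\<^sup>2 \<ge> 1 + (b'\<^sup>2 + c'\<^sup>2 + d'\<^sup>2)" "a' > 0"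
    using v V pseudo_inner_e0[of v] by (simp_all add: U_set_def pseudo_inner_def power2_eq_square)
  have "(1 + (b * b' + c * c' + d * d'))\<^sup>2 + ((b - b')\<^sup>2 + (c - c')\<^sup>2 + (d - d')\<^sup>2
      + (b * c' - c * b')\<^sup>2 + (c * d' - d * c')\<^sup>2 + (d * b' - b * d')\<^sup>2)
      = (1 + (b\<^sup>2 + c\<^sup>2 + d\<^sup>2)) * (1 + (b'\<^sup>2 + c'\<^sup>2 + d'\<^sup>2))"
    by (simp add: power2_eq_square algebra_simps)
  then have "(1 + (b * b' + c * c' + d * d'))\<^sup>2
      \<le> (1 + (b\<^sup>2 + c\<^sup>2 + d\<^sup>2)) * (1 + (b'\<^sup>2 + c'\<^sup>2 + d'\<^sup>2))"
    by (smt (verit) zero_le_power2)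
  also have "\<dots> \<le> a\<^sup>2 * a'\<^sup>2"
    unfolding X1(1) using v1 by (intro mult_left_mono) auto
  finally have "(1 + (b * b' + c * c' + d * d'))\<^sup>2 \<le> (a * a')\<^sup>2"
    by (simp only: power_mult_distrib)
  moreover have "0 \<le> a * a'" using X1(2) v1(2) by simp
  ultimately have "1 + (b * b' + c * c' + d * d') \<le> a * a'" by (rule power2_le_imp_le)
  then show ?thesis by (simp add: pseudo_inner_def X V)
qed

text \<open>Infinitesimal invariance of the pseudoscalar product under the bracket: the Hermitian part of
  \<open>[X, w]\<close> is a cross product with the spatial part of \<open>X\<close>, hence orthogonal to it.\<close>

lemma pseudo_inner_lie_bracket:
  assumes "X \<in> Herm"
  shows "pseudo_inner X (lie_bracket X w) = 0"
proof -
  obtain a b c d where X: "X = a *\<^sub>R e0 + b *\<^sub>R e1 + c *\<^sub>R e2 + d *\<^sub>R e3"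
    using Herm_expansion[OF assms] by blast
  show ?thesis
    unfolding pseudo_inner_def X herm_coord_combination herm_coord_e
    by (simp add: lie_bracket_def matrix_entries e0_def e1_def e2_def e3_def field_simps)
qed

lemma herm_coord_minus_i_Herm:
  assumes "h \<in> Herm"
  shows "herm_coord e1 (mat (- \<i>) ** h) = 0" "herm_coord e2 (mat (- \<i>) ** h) = 0"
    "herm_coord e3 (mat (- \<i>) ** h) = 0"
proof -
  obtain a b c d where h: "h = a *\<^sub>R e0 + b *\<^sub>R e1 + c *\<^sub>R e2 + d *\<^sub>R e3"
    using Herm_expansion[OF assms] by blast
  show "herm_coord e1 (mat (- \<i>) ** h) = 0" "herm_coord e2 (mat (- \<i>) ** h) = 0"
    "herm_coord e3 (mat (- \<i>) ** h) = 0"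
    unfolding h herm_coord_e by (simp_all add: matrix_entries e0_def e1_def e2_def e3_def)
qed

text \<open>The skew-Hermitian part of \<open>[X, w]\<close> comes from the Hermitian part of \<open>w\<close>, and is \<open>-i\<close> times the
  cross product of spatial vectors.\<close>

lemma herm_coord_minus_i_lie_bracket:
  assumes "X \<in> Herm"
  shows "herm_coord e1 (mat (- \<i>) ** lie_bracket X w)
      = herm_coord e3 X * herm_coord e2 w - herm_coord e2 X * herm_coord e3 w"
    "herm_coord e2 (mat (- \<i>) ** lie_bracket X w)
      = herm_coord e1 X * herm_coord e3 w - herm_coord e3 X * herm_coord e1 w"
    "herm_coord e3 (mat (- \<i>) ** lie_bracket X w)
      = herm_coord e2 X * herm_coord e1 w - herm_coord e1 X * herm_coord e2 w"
proof -
  obtain a b c d where X: "X = a *\<^sub>R e0 + b *\<^sub>R e1 + c *\<^sub>R e2 + d *\<^sub>R e3"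
    using Herm_expansion[OF assms] by blast
  show "herm_coord e1 (mat (- \<i>) ** lie_bracket X w)
      = herm_coord e3 X * herm_coord e2 w - herm_coord e2 X * herm_coord e3 w"
    "herm_coord e2 (mat (- \<i>) ** lie_bracket X w)
      = herm_coord e1 X * herm_coord e3 w - herm_coord e3 X * herm_coord e1 w"
    "herm_coord e3 (mat (- \<i>) ** lie_bracket X w)
      = herm_coord e2 X * herm_coord e1 w - herm_coord e1 X * herm_coord e2 w"
    unfolding X herm_coord_combination unfolding herm_coord_e
    by (simp_all add: lie_bracket_def matrix_entries e0_def e1_def e2_def e3_def field_simps)
qed

lemma herm_coord_minus_i_i_e:
  "herm_coord e1 (mat (- \<i>) ** (mat \<i> ** h)) = herm_coord e1 h"
  "herm_coord e2 (mat (- \<i>) ** (mat \<i> ** h)) = herm_coord e2 h"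
  "herm_coord e3 (mat (- \<i>) ** (mat \<i> ** h)) = herm_coord e3 h"
  by (simp_all add: herm_coord_e matrix_entries)

section \<open>Controls of nonstrictly abnormal extremals\<close>

text \<open>The expansion \<open>\<bar>p\<bar>\<^sup>2 a = p (p \<bullet> a) - p \<times> (p \<times> a)\<close> recovers a vector from its dot and cross product
  with \<open>p\<close>.\<close>

lemma vec3_eq_of_eq_dot_and_parallel:
  fixes p1 p2 p3 :: real
  assumes "p1\<^sup>2 + p2\<^sup>2 + p3\<^sup>2 \<noteq> 0"
    and u: "u2 * p3 = u3 * p2" "u3 * p1 = u1 * p3" "u1 * p2 = u2 * p1"
    and v: "v2 * p3 = v3 * p2" "v3 * p1 = v1 * p3" "v1 * p2 = v2 * p1"
    and dot: "u1 * p1 + u2 * p2 + u3 * p3 = v1 * p1 + v2 * p2 + v3 * p3"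
  shows "u1 = v1" "u2 = v2" "u3 = v3"
proof -
  have triple: "(p1\<^sup>2 + p2\<^sup>2 + p3\<^sup>2) * a = p1 * (a * p1 + b * p2 + c * p3) - p3 * (c * p1 - a * p3) + p2 * (a * p2 - b * p1)"
    "(p1\<^sup>2 + p2\<^sup>2 + p3\<^sup>2) * b = p2 * (a * p1 + b * p2 + c * p3) - p1 * (a * p2 - b * p1) + p3 * (b * p3 - c * p2)"
    "(p1\<^sup>2 + p2\<^sup>2 + p3\<^sup>2) * c = p3 * (a * p1 + b * p2 + c * p3) - p2 * (b * p3 - c * p2) + p1 * (c * p1 - a * p3)"
    for a b c
    by (simp_all add: power2_eq_square algebra_simps)
  have "(p1\<^sup>2 + p2\<^sup>2 + p3\<^sup>2) * u1 = (p1\<^sup>2 + p2\<^sup>2 + p3\<^sup>2) * v1"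
    "(p1\<^sup>2 + p2\<^sup>2 + p3\<^sup>2) * u2 = (p1\<^sup>2 + p2\<^sup>2 + p3\<^sup>2) * v2"
    "(p1\<^sup>2 + p2\<^sup>2 + p3\<^sup>2) * u3 = (p1\<^sup>2 + p2\<^sup>2 + p3\<^sup>2) * v3"
    unfolding triple(1)[of u1 u2 u3] triple(2)[of u2 u1 u3] triple(3)[of u3 u1 u2]
      triple(1)[of v1 v2 v3] triple(2)[of v2 v1 v3] triple(3)[of v3 v1 v2]
    by (simp_all add: u v dot)
  then show "u1 = v1" "u2 = v2" "u3 = v3" using assms(1) by auto
qed

lemma velocity_unique:
  assumes "g t \<in> GL_plus"
    and "(g has_vector_derivative g t ** u) (at t)" "(g has_vector_derivative g t ** v) (at t)"
  shows "u = v"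
proof -
  have "det (g t) \<noteq> 0" using assms(1) by (auto simp: GL_plus_def)
  then obtain h where "h ** g t = mat 1"
    using invertible_det_nz invertible_left_inverse by blast
  moreover have "g t ** u = g t ** v"
    using vector_derivative_unique_at assms(2,3) by blast
  ultimately show ?thesis by (metis matrix_mul_assoc matrix_mul_lid)
qed

text \<open>A conservation law: a direction annihilated by the right-hand side of the adjoint equation is a
  first integral.\<close>

lemma coadjoint_constant:
  assumes \<psi>: "covector_function \<psi>" and w: "w \<in> gl_plus"
    and der: "AE t in lebesgue. \<forall>w\<in>gl_plus.
           ((\<lambda>s. \<psi> s w) has_real_derivative \<psi> t (lie_bracket (u t) w)) (at t)"
    and zero: "AE t in lebesgue. \<psi> t (lie_bracket (u t) w) = 0"
  shows "\<psi> s w = \<psi> t w"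
proof (rule abs_continuous_zero_derivative_constant[where f = "\<lambda>t. \<psi> t w"])
  show "abs_continuous_on {a..b} (\<lambda>t. \<psi> t w)" for a b
    using \<psi> w unfolding covector_function_def by blast
  show "AE t in lebesgue. ((\<lambda>t. \<psi> t w) has_real_derivative 0) (at t)"
    using der zero by eventually_elim (use w in auto)
qed

text \<open>An extremal may come with a different control for each of its covector functions. Its velocity
  determines the control almost everywhere, so a single control \<open>u\<close> can be used for all of them;
  this allows an abnormal and a normal covector function to be compared.\<close>

lemma extremal_control_AE:
  assumes "extremal_wrt g \<psi> M" and u: "timelike_curve g u"
  shows "covector_function \<psi>"
    and "AE t in lebesgue. \<forall>w\<in>gl_plus.
           ((\<lambda>s. \<psi> s w) has_real_derivative \<psi> t (lie_bracket (u t) w)) (at t)"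
    and "AE t in lebesgue. \<forall>h\<in>Herm. \<psi> t h = M * pseudo_inner (u t) h"
proof -
  obtain v where v: "timelike_curve g v" and \<psi>: "covector_function \<psi>"
    and der: "AE t in lebesgue. \<forall>w\<in>gl_plus.
           ((\<lambda>s. \<psi> s w) has_real_derivative \<psi> t (lie_bracket (v t) w)) (at t)"
    and min: "AE t in lebesgue. is_arg_min (\<psi> t) (\<lambda>v. v \<in> U_set) (v t) \<and> \<psi> t (v t) = M"
    using assms(1) unfolding extremal_wrt_def by blast
  have unit: "AE t in lebesgue. pseudo_inner (v t) (v t) = 1"
    and dv: "AE t in lebesgue. (g has_vector_derivative g t ** v t) (at t)"
    using v unfolding timelike_curve_def by blast+
  have du: "AE t in lebesgue. (g has_vector_derivative g t ** u t) (at t)"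
    using u unfolding timelike_curve_def by blast
  have eq: "AE t in lebesgue. u t = v t"
    using du dv
  proof eventually_elim
    case (elim t)
    then show ?case using velocity_unique u unfolding timelike_curve_def by blast
  qed
  show "covector_function \<psi>" by (rule \<psi>)
  show "AE t in lebesgue. \<forall>w\<in>gl_plus.
           ((\<lambda>s. \<psi> s w) has_real_derivative \<psi> t (lie_bracket (u t) w)) (at t)"
    using der eq by eventually_elim simp
  show "AE t in lebesgue. \<forall>h\<in>Herm. \<psi> t h = M * pseudo_inner (u t) h"
    using min unit eq
  proof eventually_elim
    case (elim t)
    have "covector (\<psi> t)" using \<psi> unfolding covector_function_def by blast
    then show ?case
      using minimizing_covector_on_Herm[of "\<psi> t" "v t"] elim by metis
  qed
qed

text \<open>An abnormal covector function vanishes on Herm at every time, by continuity. Since brackets of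
  the control with skew-Hermitian matrices lie in Herm, the values \<open>p\<close> of the
  covector at \<open>i e1, i e2, i e3\<close> are constant, and they are not all zero because the covector is not. On a Hermitian \<open>h\<close> both the covector and
  its derivative vanish, so \<open>p\<close> annihilates all brackets of the control with Hermitian matrices:
  the cross product of \<open>p\<close> with the spatial part of the control is zero.\<close>

lemma abnormal_extremal_control_parallel:
  assumes ext: "extremal_wrt g \<psi> 0" and u: "timelike_curve g u"
  obtains p1 p2 p3 :: real where "p1\<^sup>2 + p2\<^sup>2 + p3\<^sup>2 \<noteq> 0"
    and "AE t in lebesgue. herm_coord e2 (u t) * p3 = herm_coord e3 (u t) * p2
      \<and> herm_coord e3 (u t) * p1 = herm_coord e1 (u t) * p3
      \<and> herm_coord e1 (u t) * p2 = herm_coord e2 (u t) * p1"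
proof -
  note \<psi> = extremal_control_AE(1)[OF ext u] and der = extremal_control_AE(2)[OF ext u]
  have cov: "covector (\<psi> t)" for t using \<psi> unfolding covector_function_def by blast
  have u_Herm: "u t \<in> Herm" for t using u unfolding timelike_curve_def U_set_def by blast
  have Herm_0: "\<psi> t h = 0" if "h \<in> Herm" for t h
  proof (rule continuous_ae_constant_imp_constant[where f = "\<lambda>t. \<psi> t h"])
    show "continuous_on UNIV (\<lambda>t. \<psi> t h)"
      using \<psi> that Herm_subset_gl_plus unfolding covector_function_def
      by (intro abs_continuous_imp_continuous) blast
    show "AE t in lebesgue. \<psi> t h = 0"
      using extremal_control_AE(3)[OF ext u] by eventually_elim (use that in simp)
  qed
  have const: "\<psi> t (mat \<i> ** e1) = \<psi> 0 (mat \<i> ** e1)" "\<psi> t (mat \<i> ** e2) = \<psi> 0 (mat \<i> ** e2)"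
    "\<psi> t (mat \<i> ** e3) = \<psi> 0 (mat \<i> ** e3)" for t
    by (intro coadjoint_constant[OF \<psi> _ der] i_e_in_gl_plus AE_I2 Herm_0 lie_bracket_Herm_i_e u_Herm)+
  define p1 where "p1 = \<psi> 0 (mat \<i> ** e1)"
  define p2 where "p2 = \<psi> 0 (mat \<i> ** e2)"
  define p3 where "p3 = \<psi> 0 (mat \<i> ** e3)"
  note lin = covector_linear[OF cov] subspace_add[OF gl_plus_subspace] subspace_scale[OF gl_plus_subspace]
    i_e_in_gl_plus subsetD[OF Herm_subset_gl_plus]
  have "p1\<^sup>2 + p2\<^sup>2 + p3\<^sup>2 \<noteq> 0"
  proof
    assume "p1\<^sup>2 + p2\<^sup>2 + p3\<^sup>2 = 0"
    then have 0: "p1 = 0" "p2 = 0" "p3 = 0"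
      by (smt (verit) zero_le_power2 zero_eq_power2)+
    obtain w where w: "w \<in> gl_plus" "\<psi> 0 w \<noteq> 0" using \<psi> unfolding covector_function_def by blast
    have "\<psi> 0 w = 0"
      using 0 by (subst gl_plus_expansion[OF w(1)])
        (simp add: lin e_in_Herm Herm_0 Herm_combination p1_def p2_def p3_def)
    with w show False by simp
  qed
  moreover have "AE t in lebesgue. herm_coord e2 (u t) * p3 = herm_coord e3 (u t) * p2
      \<and> herm_coord e3 (u t) * p1 = herm_coord e1 (u t) * p3
      \<and> herm_coord e1 (u t) * p2 = herm_coord e2 (u t) * p1"
    using der
  proof eventually_elim
    case (elim t)
    \<comment> \<open>the evaluation at \<open>h\<close> is identically 0, and so is its derivative\<close>
    have bracket_0: "\<psi> t (lie_bracket (u t) h) = 0" if "h \<in> Herm" for h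
    proof (rule DERIV_unique)
      show "((\<lambda>s. \<psi> s h) has_real_derivative \<psi> t (lie_bracket (u t) h)) (at t)"
        using elim that Herm_subset_gl_plus by blast
      show "((\<lambda>s. \<psi> s h) has_real_derivative 0) (at t)"
        by (simp add: Herm_0[OF that])
    qed
    show ?case
      using bracket_0[OF e_in_Herm(2)] bracket_0[OF e_in_Herm(3)] bracket_0[OF e_in_Herm(4)]
      unfolding lie_bracket_Herm_e[OF u_Herm]
      by (simp add: lin const[of t] p1_def[symmetric] p2_def[symmetric] p3_def[symmetric])
  qed
  ultimately show ?thesis by (rule that)
qed

lemma lie_bracket_parallel:
  assumes u: "u \<in> Herm" and "herm_coord e2 u * p3 = herm_coord e3 u * p2"
    "herm_coord e3 u * p1 = herm_coord e1 u * p3" "herm_coord e1 u * p2 = herm_coord e2 u * p1"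
  shows "lie_bracket u (p1 *\<^sub>R e1 + p2 *\<^sub>R e2 + p3 *\<^sub>R e3) = 0"
proof -
  have "lie_bracket u (p1 *\<^sub>R e1 + p2 *\<^sub>R e2 + p3 *\<^sub>R e3)
      = p1 *\<^sub>R lie_bracket u e1 + p2 *\<^sub>R lie_bracket u e2 + p3 *\<^sub>R lie_bracket u e3"
    by (simp add: lie_bracket_def matrix_mult.add_left matrix_mult.add_right
        matrix_mult.scaleR_left matrix_mult.scaleR_right algebra_simps)
  also have "\<dots> = (p2 * herm_coord e3 u - p3 * herm_coord e2 u) *\<^sub>R (mat \<i> ** e1)
      + (p3 * herm_coord e1 u - p1 * herm_coord e3 u) *\<^sub>R (mat \<i> ** e2)
      + (p1 * herm_coord e2 u - p2 * herm_coord e1 u) *\<^sub>R (mat \<i> ** e3)"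
    unfolding lie_bracket_Herm_e[OF u] by (simp add: algebra_simps)
  also have "\<dots> = 0" using assms(2-4) by (simp add: mult.commute)
  finally show ?thesis .
qed

text \<open>The abnormal covector function fixes the direction \<open>p\<close> of the spatial part of the control. The
  matrix \<open>P\<close> with these coordinates and the central element \<open>e0\<close> both commute with the control, so
  the normal covector function is constant on them. By the Legendre correspondence, its values there
  are \<open>M\<close> times the time coordinate of the control and \<open>-M\<close> times the dot product of its spatial part
  with \<open>p\<close>; together with the direction these determine the control.\<close>

lemma nonstrictly_abnormal_control_constant:
  assumes abn: "extremal_wrt g \<psi> 0" and nor: "extremal_wrt g \<phi> M" and "M > 0"
  obtains X where "X \<in> Herm" "pseudo_inner X X = 1"
    "AE t in lebesgue. (g has_vector_derivative g t ** X) (at t)"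
proof -
  obtain u where u: "timelike_curve g u" using abn unfolding extremal_wrt_def by blast
  have u_Herm: "u t \<in> Herm" for t using u unfolding timelike_curve_def U_set_def by blast
  obtain p1 p2 p3 :: real where p: "p1\<^sup>2 + p2\<^sup>2 + p3\<^sup>2 \<noteq> 0"
    and par: "AE t in lebesgue. herm_coord e2 (u t) * p3 = herm_coord e3 (u t) * p2
      \<and> herm_coord e3 (u t) * p1 = herm_coord e1 (u t) * p3
      \<and> herm_coord e1 (u t) * p2 = herm_coord e2 (u t) * p1"
    using abnormal_extremal_control_parallel[OF abn u] by blast
  note \<phi> = extremal_control_AE[OF nor u]
  have cov: "covector (\<phi> t)" for t using \<phi>(1) unfolding covector_function_def by blast
  define P where "P = p1 *\<^sub>R e1 + p2 *\<^sub>R e2 + p3 *\<^sub>R e3"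
  have P: "P \<in> Herm" using Herm_combination[of 0 p1 p2 p3] by (simp add: P_def)
  have "AE t in lebesgue. \<phi> t (lie_bracket (u t) P) = 0"
    using par by eventually_elim (simp add: P_def lie_bracket_parallel u_Herm covector_linear[OF cov])
  then have P_const: "\<phi> t P = \<phi> 0 P" for t
    using P Herm_subset_gl_plus by (intro coadjoint_constant[OF \<phi>(1) _ \<phi>(2)]) auto
  have e0_const: "\<phi> t e0 = \<phi> 0 e0" for t
    using e_in_Herm Herm_subset_gl_plus
    by (intro coadjoint_constant[OF \<phi>(1) _ \<phi>(2)])
      (auto simp: lie_bracket_Herm_e u_Herm covector_linear[OF cov])
  have inner_P: "pseudo_inner h P = - (herm_coord e1 h * p1 + herm_coord e2 h * p2 + herm_coord e3 h * p3)" for h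
    using herm_coord_combination[of 0 p1 p2 p3] by (simp add: pseudo_inner_def P_def)
  have good: "AE t in lebesgue. M * herm_coord e0 (u t) = \<phi> 0 e0
      \<and> M * (herm_coord e1 (u t) * p1 + herm_coord e2 (u t) * p2 + herm_coord e3 (u t) * p3) = - \<phi> 0 P
      \<and> herm_coord e2 (u t) * p3 = herm_coord e3 (u t) * p2
      \<and> herm_coord e3 (u t) * p1 = herm_coord e1 (u t) * p3
      \<and> herm_coord e1 (u t) * p2 = herm_coord e2 (u t) * p1"
    using \<phi>(3) par
  proof eventually_elim
    case (elim t)
    have "M * herm_coord e0 (u t) = \<phi> 0 e0"
      using elim(1) e0_const[of t] e_in_Herm(1) by (metis pseudo_inner_e0)
    moreover have "M * (- (herm_coord e1 (u t) * p1 + herm_coord e2 (u t) * p2 + herm_coord e3 (u t) * p3)) = \<phi> 0 P"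
      using elim(1) P_const[of t] P by (metis inner_P)
    ultimately show ?case using elim(2) by (simp add: algebra_simps)
  qed
  have "AE t in lebesgue. pseudo_inner (u t) (u t) = 1"
    using u unfolding timelike_curve_def by blast
  with good obtain s where s: "pseudo_inner (u s) (u s) = 1"
      "M * herm_coord e0 (u s) = \<phi> 0 e0"
      "M * (herm_coord e1 (u s) * p1 + herm_coord e2 (u s) * p2 + herm_coord e3 (u s) * p3) = - \<phi> 0 P"
      "herm_coord e2 (u s) * p3 = herm_coord e3 (u s) * p2"
      "herm_coord e3 (u s) * p1 = herm_coord e1 (u s) * p3"
      "herm_coord e1 (u s) * p2 = herm_coord e2 (u s) * p1"
    using AE_lebesgue_obtain[OF AE_conjI[OF _ good]] by blast
  have "AE t in lebesgue. (g has_vector_derivative g t ** u t) (at t)"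
    using u unfolding timelike_curve_def by blast
  then have "AE t in lebesgue. (g has_vector_derivative g t ** u s) (at t)"
    using good
  proof eventually_elim
    case (elim t)
    have e0: "herm_coord e0 (u t) = herm_coord e0 (u s)"
      and dot: "herm_coord e1 (u t) * p1 + herm_coord e2 (u t) * p2 + herm_coord e3 (u t) * p3
        = herm_coord e1 (u s) * p1 + herm_coord e2 (u s) * p2 + herm_coord e3 (u s) * p3"
      using elim(2) s(2,3) \<open>M > 0\<close> by (metis less_irrefl mult_cancel_left)+
    have "herm_coord e1 (u t) = herm_coord e1 (u s)" "herm_coord e2 (u t) = herm_coord e2 (u s)"
      "herm_coord e3 (u t) = herm_coord e3 (u s)"
      using vec3_eq_of_eq_dot_and_parallel[OF p _ _ _ s(4-6) dot] elim(2) by blast+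
    then have "u t = u s"
      using Herm_expansion[OF u_Herm[of t]] Herm_expansion[OF u_Herm[of s]] e0 by simp
    then show ?case using elim(1) by simp
  qed
  then show ?thesis using that[OF u_Herm s(1)] by blast
qed

section \<open>Curves with constant control\<close>

text \<open>The known control \<open>u\<close> agrees with \<open>X\<close> at some time, which shows that \<open>X\<close> points to the future.\<close>

lemma timelike_curve_constant_control:
  assumes "timelike_curve g u" and X: "X \<in> Herm" "pseudo_inner X X = 1"
    and der: "\<And>t. (g has_vector_derivative g t ** X) (at t)"
  shows "timelike_curve g (\<lambda>_. X)"
proof -
  have "AE t in lebesgue. (g has_vector_derivative g t ** u t) (at t)"
    using assms(1) unfolding timelike_curve_def by blast
  then obtain t where "(g has_vector_derivative g t ** u t) (at t)" by (rule AE_lebesgue_obtain)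
  then have "u t = X"
    using velocity_unique der assms(1) unfolding timelike_curve_def by blast
  then have "X \<in> U_set" using assms(1) unfolding timelike_curve_def by metis
  then show ?thesis using assms unfolding timelike_curve_def by simp
qed

lemma extremal_constant_covector:
  assumes "timelike_curve g (\<lambda>_. X)" and f: "covector f" "w \<in> gl_plus" "f w \<noteq> 0"
    and inv: "\<And>w. w \<in> gl_plus \<Longrightarrow> f (lie_bracket X w) = 0"
    and min: "is_arg_min f (\<lambda>v. v \<in> U_set) X" and "f X \<ge> 0"
  shows "extremal_wrt g (\<lambda>_. f) (f X)"
proof -
  have "covector_function (\<lambda>_. f)"
    using f unfolding covector_function_def abs_continuous_on_def
    by (auto intro: exI[of _ "1 :: real"])
  then show ?thesis
    unfolding extremal_wrt_def using assms(1,7) min inv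
    by (intro exI[of _ "\<lambda>_. X"]) simp
qed

text \<open>The covector metrically dual to \<open>X\<close> is invariant along the curve and attains its minimum over
  \<open>U_set\<close> at \<open>X\<close>, by the reversed Cauchy-Schwarz inequality.\<close>

lemma constant_control_normal:
  assumes g: "timelike_curve g (\<lambda>_. X)" and X: "X \<in> Herm" "pseudo_inner X X = 1"
  shows "extremal_wrt g (\<lambda>_. pseudo_inner X) 1"
proof -
  have "X \<in> U_set" using g unfolding timelike_curve_def by blast
  then have pos: "herm_coord e0 X > 0" by (simp add: U_set_def pseudo_inner_e0)
  have "is_arg_min (pseudo_inner X) (\<lambda>v. v \<in> U_set) X"
    unfolding is_arg_min_def using \<open>X \<in> U_set\<close> reversed_Cauchy_Schwarz[OF X pos] X(2)
    by (auto simp: not_less)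
  moreover have "covector (pseudo_inner X)"
    by (simp add: covector_def pseudo_inner_def herm_coord_linear algebra_simps)
  ultimately show ?thesis
    using extremal_constant_covector[OF g, of "pseudo_inner X" X] X Herm_subset_gl_plus
    by (auto simp: pseudo_inner_lie_bracket)
qed

text \<open>The covector lives on the skew-Hermitian part and is given there by a spatial vector \<open>p\<close>
  parallel to that of \<open>X\<close>. When \<open>X\<close> is a multiple of \<open>e0\<close>, every \<open>p\<close> is parallel to it, and \<open>e1\<close> is
  chosen.\<close>

lemma constant_control_abnormal:
  assumes g: "timelike_curve g (\<lambda>_. X)" and X: "X \<in> Herm"
  shows "\<exists>\<psi>. extremal_wrt g \<psi> 0"
proof -
  have U: "X \<in> U_set" using g unfolding timelike_curve_def by blast
  obtain p where p: "p \<in> Herm" "(herm_coord e1 p)\<^sup>2 + (herm_coord e2 p)\<^sup>2 + (herm_coord e3 p)\<^sup>2 \<noteq> 0"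
    and par: "herm_coord e2 X * herm_coord e3 p = herm_coord e3 X * herm_coord e2 p"
      "herm_coord e3 X * herm_coord e1 p = herm_coord e1 X * herm_coord e3 p"
      "herm_coord e1 X * herm_coord e2 p = herm_coord e2 X * herm_coord e1 p"
  proof (cases "(herm_coord e1 X)\<^sup>2 + (herm_coord e2 X)\<^sup>2 + (herm_coord e3 X)\<^sup>2 = 0")
    case True
    then have "herm_coord e1 X = 0" "herm_coord e2 X = 0" "herm_coord e3 X = 0"
      by (smt (verit) zero_le_power2 zero_eq_power2)+
    then show ?thesis
      using that[of e1] e_in_Herm(2) herm_coord_combination[of 0 1 0 0] by simp
  next
    case False
    then show ?thesis using that[of X] X by (simp add: mult.commute)
  qed
  define f where "f w = herm_coord e1 p * herm_coord e1 (mat (- \<i>) ** w)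
    + herm_coord e2 p * herm_coord e2 (mat (- \<i>) ** w)
    + herm_coord e3 p * herm_coord e3 (mat (- \<i>) ** w)" for w
  have f_Herm: "f h = 0" if "h \<in> Herm" for h
    by (simp add: f_def herm_coord_minus_i_Herm[OF that])
  have "covector f"
    by (simp add: covector_def f_def matrix_mult.add_right matrix_mult.scaleR_right
        herm_coord_linear algebra_simps)
  \<comment> \<open>\<open>i\<close> times the traceless part of \<open>p\<close>, where \<open>f\<close> takes the value \<open>\<bar>p\<bar>\<^sup>2\<close>\<close>
  moreover have "mat \<i> ** (p - herm_coord e0 p *\<^sub>R e0) \<in> gl_plus"
  proof -
    have "p - herm_coord e0 p *\<^sub>R e0 = herm_coord e1 p *\<^sub>R e1 + herm_coord e2 p *\<^sub>R e2 + herm_coord e3 p *\<^sub>R e3"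
      using Herm_expansion[OF p(1)] by (simp add: algebra_simps)
    then show ?thesis
      by (simp add: matrix_mult.add_right matrix_mult.scaleR_right i_e_in_gl_plus
          subspace_add[OF gl_plus_subspace] subspace_scale[OF gl_plus_subspace])
  qed
  moreover have "f (mat \<i> ** (p - herm_coord e0 p *\<^sub>R e0)) \<noteq> 0"
    using p(2) herm_coord_combination[of 1 0 0 0]
    by (simp add: f_def herm_coord_minus_i_i_e herm_coord_linear power2_eq_square)
  moreover have "f (lie_bracket X w) = 0" for w
  proof -
    have "f (lie_bracket X w)
        = herm_coord e1 w * (herm_coord e2 X * herm_coord e3 p - herm_coord e3 X * herm_coord e2 p)
        + herm_coord e2 w * (herm_coord e3 X * herm_coord e1 p - herm_coord e1 X * herm_coord e3 p)
        + herm_coord e3 w * (herm_coord e1 X * herm_coord e2 p - herm_coord e2 X * herm_coord e1 p)"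
      unfolding f_def herm_coord_minus_i_lie_bracket[OF X] by (simp add: algebra_simps)
    then show ?thesis by (simp add: par)
  qed
  moreover have "is_arg_min f (\<lambda>v. v \<in> U_set) X"
    using U f_Herm unfolding is_arg_min_def U_set_def by auto
  ultimately have "extremal_wrt g (\<lambda>_. f) (f X)"
    using f_Herm[OF X] by (intro extremal_constant_covector[OF g]) auto
  then show ?thesis using f_Herm[OF X] by auto
qed

section \<open>Characterization of nonstrictly abnormal extremals\<close>

theorem proposition13:
  fixes g :: "real \<Rightarrow> complex^2^2"
  assumes "timelike_extremal g"
  shows "nonstrictly_abnormal g \<longleftrightarrow>
    unit_one_parameter_subgroup g \<or>
    (\<exists>a\<in>GL_plus. \<exists>\<gamma>. unit_one_parameter_subgroup \<gamma> \<and> (\<forall>t. g t = a ** \<gamma> t))"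
proof
  obtain u where u: "timelike_curve g u"
    using assms unfolding timelike_extremal_def extremal_wrt_def by blast
  show "unit_one_parameter_subgroup g \<or>
    (\<exists>a\<in>GL_plus. \<exists>\<gamma>. unit_one_parameter_subgroup \<gamma> \<and> (\<forall>t. g t = a ** \<gamma> t))"
    if abnormal: "nonstrictly_abnormal g"
  proof -
    obtain \<psi> \<phi> M where "extremal_wrt g \<psi> 0" "extremal_wrt g \<phi> M" "M > 0"
      using abnormal unfolding nonstrictly_abnormal_def abnormal_wrt_def normal_wrt_def by blast
    then obtain X where X: "X \<in> Herm" "pseudo_inner X X = 1"
      "AE t in lebesgue. (g has_vector_derivative g t ** X) (at t)"
      by (rule nonstrictly_abnormal_control_constant)
    have "g t = g 0 ** matrix_exp (t *\<^sub>R X)" for t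
      using u by (intro lipschitz_solution_eq_matrix_exp X) (simp add: timelike_curve_def)
    moreover have "g 0 \<in> GL_plus" using u by (simp add: timelike_curve_def)
    moreover have "unit_one_parameter_subgroup (\<lambda>t. matrix_exp (t *\<^sub>R X))"
      using X unfolding unit_one_parameter_subgroup_def by blast
    ultimately show ?thesis by blast
  qed
  show "nonstrictly_abnormal g"
    if subgroup: "unit_one_parameter_subgroup g \<or>
    (\<exists>a\<in>GL_plus. \<exists>\<gamma>. unit_one_parameter_subgroup \<gamma> \<and> (\<forall>t. g t = a ** \<gamma> t))"
  proof -
    have "\<exists>a \<gamma>. unit_one_parameter_subgroup \<gamma> \<and> (\<forall>t. g t = a ** \<gamma> t)"
      using subgroup
    proof
      assume "unit_one_parameter_subgroup g"
      then show ?thesis by (intro exI[of _ "mat 1"] exI[of _ g]) simp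
    qed blast
    then obtain a \<gamma> X where X: "X \<in> Herm" "pseudo_inner X X = 1"
      and "\<forall>t. g t = a ** \<gamma> t" "\<forall>t. \<gamma> t = matrix_exp (t *\<^sub>R X)"
      unfolding unit_one_parameter_subgroup_def by blast
    then have g: "g = (\<lambda>t. a ** matrix_exp (t *\<^sub>R X))" by auto
    have "(g has_vector_derivative g t ** X) (at t)" for t
      using matrix_mult.has_vector_derivative[OF has_vector_derivative_const
          matrix_exp_has_vector_derivative[of X t], of a]
      by (simp add: g matrix_exp_commute matrix_mul_assoc matrix_mult.zero_left)
    then have "timelike_curve g (\<lambda>_. X)"
      using timelike_curve_constant_control[OF u X] by blast
    then show ?thesis
      using constant_control_normal[OF _ X] constant_control_abnormal[OF _ X(1)] zero_less_one
      unfolding nonstrictly_abnormal_def normal_wrt_def abnormal_wrt_def by blast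
  qed
qed

end
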